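(* Let $s(n,k)$ denote the number of partial packing paths of width $n$ ending at height $k$. For integers $n,k\ge 0$ (whenever the first argument of $s$ on the left-hand side is nonnegative), $$s(4n-2k,2k)=\tfrac12\bigl(w(4n-2k,k)+w(4n-2(k-1),k+1)\bigr),$$ $$s(4n-2k-1,2k+1)=\tfrac12\bigl(w(4n-2(k-1),k+1)-w(4n-2k,k)\bigr),$$ $$s(4n-2k+1,2k+1)=w(4n-2(k-1),k+1),$$ and $s(\cdot,\cdot)=0$ for all pairs of nonnegative integers not of one of these three forms, where $w(0,0)=1$ and $$w(4n-2k,k)=\frac{k}{n}\sum_{\ell=0}^{n-k}3^{\,n-k-\ell}\binom{n+\ell-1}{\ell}\binom{n}{n-k-\ell},\qquad n\ge1,\ k\ge0$$ (so that $w(4n-2(k-1),k+1)=w(4(n+1)-2(k+1),k+1)$ is given by this formula with $(n,k)$ replaced by $(n+1,k+1)$; an empty sum is $0$).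
   Context: Consider the hexagonal packing of the plane by circles of radius $2$ with centers $(2+4i+2j,\,2\sqrt3\,j)$, $i,j\in\mathbb Z$; the origin is the tangency point of two horizontally adjacent circles. The tangency points cut every circle into six arcs. Traversed from left to right these give six types of steps (angles measured on the circle carrying the arc): $U$ from $180^\circ$ to $120^\circ$ (displacement $(1,\sqrt3)$), $F$ from $120^\circ$ to $60^\circ$ (displacement $(2,0)$), $D$ from $60^\circ$ to $0^\circ$ (displacement $(1,-\sqrt3)$), $\overline U$ from $300^\circ$ to $360^\circ$ (displacement $(1,\sqrt3)$), $\overline F$ from $240^\circ$ to $300^\circ$ (displacement $(2,0)$), $\overline D$ from $180^\circ$ to $240^\circ$ (displacement $(1,-\sqrt3)$). A path in the packing starts at the origin, is a concatenation of such arcs of circles of the packing, each starting where the previous one ends, and stays in the quarter plane $x,y\ge 0$. Equivalently, it is a word in $\{U,F,D,\overline U,\overline F,\overline D\}$ whose first step (if any) is $U$, in which $U$ or $\overline F$ can only be followed by $F$ or $\overline U$; $F$ or $\overline D$ only by $\overline F$ or $D$; $\overline U$ or $D$ only by $U$ or $\overline D$; and which never goes below ordinate $0$. A packing path is such a path ending on the $x$-axis; a partial packing path is any prefix of a packing path. The empty path is allowed. The width of a path is the abscissa of its endpoint (so $U,D,\overline U,\overline D$ contribute $1$ and $F,\overline F$ contribute $2$). The (final) height of a path is the integer $k$ such that its endpoint has ordinate $k\sqrt3$. *)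

theory Defs
  imports Complex_Main "HOL-Library.Sublist"
begin

definition circle_center :: "int \<Rightarrow> int \<Rightarrow> complex" where
  "circle_center i j =
     Complex (2 + 4 * of_int i + 2 * of_int j) (2 * sqrt 3 * of_int j)"

text \<open>The constructors with suffix \<open>b\<close> are the overlined steps; these run along the lower
  half of their circle.\<close>

datatype step = U | F | D | Ub | Fb | Db

fun start_angle :: "step \<Rightarrow> real" where
  "start_angle U = pi"
| "start_angle F = 2 * pi / 3"
| "start_angle D = pi / 3"
| "start_angle Ub = 5 * pi / 3"
| "start_angle Fb = 4 * pi / 3"
| "start_angle Db = pi"

fun end_angle :: "step \<Rightarrow> real" where
  "end_angle U = 2 * pi / 3"
| "end_angle F = pi / 3"
| "end_angle D = 0"
| "end_angle Ub = 2 * pi"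
| "end_angle Fb = 5 * pi / 3"
| "end_angle Db = 4 * pi / 3"

text \<open>An arc \<open>(i, j, t)\<close> is the arc of type \<open>t\<close> on the circle with center
  \<open>circle_center i j\<close> and radius 2.\<close>

type_synonym arc = "int \<times> int \<times> step"

definition circle_point :: "arc \<Rightarrow> real \<Rightarrow> complex" where
  "circle_point a \<theta> = (case a of (i, j, t) \<Rightarrow> circle_center i j + rcis 2 \<theta>)"

definition arc_start :: "arc \<Rightarrow> complex" where
  "arc_start a = circle_point a (start_angle (snd (snd a)))"

definition arc_end :: "arc \<Rightarrow> complex" where
  "arc_end a = circle_point a (end_angle (snd (snd a)))"

text \<open>On overlined arcs the angle increases along the path, on the others it decreases.\<close>

definition arc_points :: "arc \<Rightarrow> complex set" where
  "arc_points a = (let \<alpha> = start_angle (snd (snd a)); \<beta> = end_angle (snd (snd a))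
     in circle_point a ` {min \<alpha> \<beta>..max \<alpha> \<beta>})"

fun connected_from :: "complex \<Rightarrow> arc list \<Rightarrow> bool" where
  "connected_from z [] \<longleftrightarrow> True"
| "connected_from z (a # p) \<longleftrightarrow> arc_start a = z \<and> connected_from (arc_end a) p"

definition endpoint :: "arc list \<Rightarrow> complex" where
  "endpoint p = (if p = [] then 0 else arc_end (last p))"

definition path_in_packing :: "arc list \<Rightarrow> bool" where
  "path_in_packing p \<longleftrightarrow> connected_from 0 p \<and>
     (\<forall>a\<in>set p. \<forall>z\<in>arc_points a. 0 \<le> Re z \<and> 0 \<le> Im z)"

definition packing_path :: "arc list \<Rightarrow> bool" where
  "packing_path p \<longleftrightarrow> path_in_packing p \<and> Im (endpoint p) = 0"

definition partial_packing_path :: "arc list \<Rightarrow> bool" where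
  "partial_packing_path p \<longleftrightarrow> (\<exists>q. packing_path q \<and> prefix p q)"

text \<open>The width is the abscissa of the endpoint, and the height is its ordinate in units of
  \<open>sqrt 3\<close>. The set below is finite: every arc contributes at least 1 to the width, and an
  arc is determined by its starting point and its type.\<close>

definition s :: "int \<Rightarrow> nat \<Rightarrow> nat" where
  "s n k = card {p. partial_packing_path p \<and>
     Re (endpoint p) = of_int n \<and> Im (endpoint p) = of_nat k * sqrt 3}"

text \<open>The value of \<open>w (4n - 2k) k\<close> for \<open>n \<ge> 1\<close>. The index set is
  \<open>0 \<le> l \<le> n - k\<close>, read as empty for \<open>n < k\<close>, so no subtraction below truncates.\<close>

definition w_formula :: "nat \<Rightarrow> nat \<Rightarrow> real" where
  "w_formula n k = real k / real n *
     (\<Sum>l | k + l \<le> n. 3 ^ (n - k - l) * real ((n + l - 1) choose l) * real (n choose (n - k - l)))"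

text \<open>Only the pairs \<open>(0, 0)\<close> and \<open>(4n - 2k, k)\<close> with \<open>n \<ge> 1\<close> matter. Elsewhere the
  value is set to 0.\<close>

definition w :: "int \<Rightarrow> nat \<Rightarrow> real" where
  "w m k =
     (if m = 0 \<and> k = 0 then 1
      else if 0 < m + 2 * int k \<and> 4 dvd m + 2 * int k
        then w_formula (nat ((m + 2 * int k) div 4)) k
      else 0)"

lemma w_0_0: "w 0 0 = 1"
  by (simp add: w_def)

lemma w_eq_formula:
  assumes "n \<ge> 1"
  shows "w (4 * int n - 2 * int k) k = w_formula n k"
  using assms by (auto simp: w_def)

lemma w_shift_eq_formula:
  "w (4 * int n - 2 * (int k - 1)) (k + 1) = w_formula (n + 1) (k + 1)"
  using w_eq_formula[of "n + 1" "k + 1"] by (simp add: algebra_simps)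

end

theory Submission
  imports Defs "HOL-Computational_Algebra.Formal_Power_Series"
begin

text \<open>Every path in the packing can be continued down to the axis, so partial packing paths are
  the same as paths in the packing. The endpoint of a path determines which arcs can lead to
  it, and removing the last arc gives three mutual recurrences for the number of paths ending at
  a given point, one for each class of tangency points. With \<open>W n k = w (4n - 2k) k\<close>, the three
  claimed closed forms satisfy these recurrences as soon as
  \<open>W (n+1) (k+1) = W n k + 3 W n (k+1) + W (n+1) (k+2)\<close>. As \<open>W n k\<close> is \<open>k/n\<close> times the coefficient
  of \<open>u^(n-k)\<close> in \<open>P n = ((1 + 3u) / (1 - u))^n\<close>, this follows from
  \<open>(1 - u) P (n+1) = (1 + 3u) P n\<close> and the derivative of that product.\<close>

section \<open>Arcs and tangency points\<close>

text \<open>All tangency points have integer coordinates in these units, so equality of arc ends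
  becomes linear integer arithmetic.\<close>

definition lattice_point :: "int \<Rightarrow> int \<Rightarrow> complex" where
  "lattice_point x h = Complex (of_int x) (of_int h * sqrt 3)"

lemma lattice_point_sel [simp]:
  "Re (lattice_point x h) = of_int x" "Im (lattice_point x h) = of_int h * sqrt 3"
  by (simp_all add: lattice_point_def)

lemma lattice_point_eq_iff [simp]: "lattice_point x h = lattice_point x' h' \<longleftrightarrow> x = x' \<and> h = h'"
  by (simp add: lattice_point_def)

lemma zero_eq_lattice_point_iff [simp]: "0 = lattice_point x h \<longleftrightarrow> x = 0 \<and> h = 0"
  by (auto simp: complex_eq_iff)

lemma trig_240_300:
  "cos (4 * pi / 3) = - 1 / 2" "sin (4 * pi / 3) = - sqrt 3 / 2"
  "cos (5 * pi / 3) = 1 / 2" "sin (5 * pi / 3) = - sqrt 3 / 2"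
proof -
  have *: "4 * pi / 3 = 2 * pi - 2 * pi / 3" "5 * pi / 3 = 2 * pi - pi / 3"
    by simp_all
  show "cos (4 * pi / 3) = - 1 / 2" "sin (4 * pi / 3) = - sqrt 3 / 2"
    "cos (5 * pi / 3) = 1 / 2" "sin (5 * pi / 3) = - sqrt 3 / 2"
    unfolding * by (simp_all only: cos_2pi_minus sin_2pi_minus cos_120 sin_120 cos_60 sin_60)
qed

lemma arc_start_simps:
  "arc_start (i, j, U) = lattice_point (4 * i + 2 * j) (2 * j)"
  "arc_start (i, j, F) = lattice_point (4 * i + 2 * j + 1) (2 * j + 1)"
  "arc_start (i, j, D) = lattice_point (4 * i + 2 * j + 3) (2 * j + 1)"
  "arc_start (i, j, Ub) = lattice_point (4 * i + 2 * j + 3) (2 * j - 1)"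
  "arc_start (i, j, Fb) = lattice_point (4 * i + 2 * j + 1) (2 * j - 1)"
  "arc_start (i, j, Db) = lattice_point (4 * i + 2 * j) (2 * j)"
  by (simp_all add: arc_start_def circle_point_def circle_center_def complex_eq_iff
      cos_60 sin_60 cos_120 sin_120 trig_240_300) (simp_all add: algebra_simps)

lemma arc_end_simps:
  "arc_end (i, j, U) = lattice_point (4 * i + 2 * j + 1) (2 * j + 1)"
  "arc_end (i, j, F) = lattice_point (4 * i + 2 * j + 3) (2 * j + 1)"
  "arc_end (i, j, D) = lattice_point (4 * i + 2 * j + 4) (2 * j)"
  "arc_end (i, j, Ub) = lattice_point (4 * i + 2 * j + 4) (2 * j)"
  "arc_end (i, j, Fb) = lattice_point (4 * i + 2 * j + 3) (2 * j - 1)"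
  "arc_end (i, j, Db) = lattice_point (4 * i + 2 * j + 1) (2 * j - 1)"
  by (simp_all add: arc_end_def circle_point_def circle_center_def complex_eq_iff
      cos_60 sin_60 cos_120 sin_120 trig_240_300) (simp_all add: algebra_simps)

section \<open>Confinement of arcs to the quarter plane\<close>

lemma cos_ge_half:
  fixes x :: real
  assumes "0 \<le> x" "x \<le> pi / 3"
  shows "1 / 2 \<le> cos x"
  using cos_monotone_0_pi_le[of x "pi / 3"] assms by (simp add: cos_60)

lemma cos_ge_minus_half:
  fixes x :: real
  assumes "0 \<le> x" "x \<le> 2 * pi / 3"
  shows "- 1 / 2 \<le> cos x"
  using cos_monotone_0_pi_le[of x "2 * pi / 3"] assms by (simp add: cos_120)

lemma sin_le_half_sqrt_3:
  fixes x :: real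
  assumes "0 \<le> x" "x \<le> pi / 3"
  shows "sin x \<le> sqrt 3 / 2"
  using sin_monotone_2pi_le[of x "pi / 3"] assms by (simp add: sin_60)

text \<open>The abscissa increases along every arc, so its minimum is at the start. Upper arcs lie
  above their center, where \<open>0 \<le> j\<close>; on lower arcs an end at height
  \<open>2 * j - 1\<close> forces \<open>1 \<le> j\<close>, and the arc hangs at most 2 below a
  center at ordinate at least \<open>2 * sqrt 3\<close>.\<close>

lemma arc_quadrant:
  assumes "0 \<le> Re (arc_start a)" "0 \<le> Im (arc_start a)" "0 \<le> Im (arc_end a)" "z \<in> arc_points a"
  shows "0 \<le> Re z \<and> 0 \<le> Im z"
proof -
  obtain i j t where a: "a = (i, j, t)"
    by (cases a)
  from assms(4) obtain x where z: "z = circle_center i j + rcis 2 x"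
    and x: "min (start_angle t) (end_angle t) \<le> x" "x \<le> max (start_angle t) (end_angle t)"
    by (auto simp: arc_points_def a circle_point_def Let_def)
  have Re: "Re z = of_int (4 * i + 2 * j + 2) + 2 * cos x"
    and Im: "Im z = of_int (2 * j) * sqrt 3 + 2 * sin x"
    by (simp_all add: z circle_center_def)
  have sinpi: "sin (x - pi) = - sin x"
    by (simp add: sin_diff)
  \<comment> \<open>In each case below, \<open>c\<close> is 2 plus twice the cosine of the start
    angle, so \<open>4 * i + 2 * j + c\<close> is the abscissa of the start.\<close>
  have nonneg: ?thesis if "0 \<le> 4 * i + 2 * j + c" "of_int c \<le> 2 + 2 * cos x"
    "0 \<le> of_int j * sqrt 3 + sin x" for c
  proof -
    have "0 \<le> real_of_int (4 * i + 2 * j + c)"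
      using that(1) by (simp only: of_int_0_le_iff)
    then show ?thesis
      using that(2,3) by (simp add: Re Im)
  qed
  have cos_ge: "0 \<le> 2 + 2 * cos x"
    using cos_ge_minus_one[of x] by linarith
  have upper: "0 \<le> of_int j * sqrt 3 + sin x" if "1 \<le> j" "- sqrt 3 \<le> sin x"
  proof -
    have "1 * sqrt 3 \<le> of_int j * sqrt 3"
      using that(1) by (intro mult_right_mono) simp_all
    then show ?thesis
      using that(2) by linarith
  qed
  have minus_sqrt_3: "- sqrt 3 \<le> - sqrt 3 / 2"
    by simp
  show ?thesis
  proof (cases t)
    case U
    then have "0 \<le> 4 * i + 2 * j" "0 \<le> j" "0 \<le> sin x"
      using assms(1-3) x by (auto simp: a arc_start_simps arc_end_simps zero_le_mult_iff intro!: sin_ge_zero)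
    then show ?thesis
      using cos_ge by (intro nonneg[of 0]) auto
  next
    case F
    then have "0 \<le> 4 * i + 2 * j + 1" "0 \<le> j" "0 \<le> sin x" "- 1 / 2 \<le> cos x"
      using assms(1-3) x cos_ge_minus_half[of x]
      by (auto simp: a arc_start_simps arc_end_simps zero_le_mult_iff intro!: sin_ge_zero)
    then show ?thesis
      by (intro nonneg[of 1]) auto
  next
    case D
    then have "0 \<le> 4 * i + 2 * j + 3" "0 \<le> j" "0 \<le> sin x" "1 / 2 \<le> cos x"
      using assms(1-3) x cos_ge_half[of x]
      by (auto simp: a arc_start_simps arc_end_simps zero_le_mult_iff intro!: sin_ge_zero)
    then show ?thesis
      by (intro nonneg[of 3]) auto
  next
    case Ub
    then have "0 \<le> 4 * i + 2 * j + 3" "1 \<le> j" "- sqrt 3 / 2 \<le> sin x" "1 / 2 \<le> cos x"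
      \<comment> \<open>Reflection in the horizontal diameter carries the lower arc to angles in the
        first sextant.\<close>
      using assms(1-3) x cos_ge_half[of "2 * pi - x"] sin_le_half_sqrt_3[of "2 * pi - x"]
      by (auto simp: a arc_start_simps arc_end_simps zero_le_mult_iff)
    then show ?thesis
      by (intro nonneg[of 3] upper order_trans[OF minus_sqrt_3]) auto
  next
    case Fb
    then have "0 \<le> 4 * i + 2 * j + 1" "1 \<le> j" "- 1 / 2 \<le> cos x"
      using assms(1-3) x cos_ge_minus_half[of "2 * pi - x"]
      by (auto simp: a arc_start_simps arc_end_simps zero_le_mult_iff)
    moreover have "- sqrt 3 \<le> sin x"
      using sin_ge_minus_one[of x] real_sqrt_ge_1_iff[of 3] by linarith
    ultimately show ?thesis
      by (intro nonneg[of 1] upper) auto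
  next
    case Db
    then have "0 \<le> 4 * i + 2 * j" "1 \<le> j" "- sqrt 3 / 2 \<le> sin x"
      using assms(1-3) x sin_le_half_sqrt_3[of "x - pi"]
      by (auto simp: a arc_start_simps arc_end_simps zero_le_mult_iff sinpi)
    then show ?thesis
      using cos_ge by (intro nonneg[of 0] upper order_trans[OF minus_sqrt_3]) auto
  qed
qed

section \<open>Paths by endpoint\<close>

lemma arc_end_in_arc_points: "arc_end a \<in> arc_points a"
  by (auto simp: arc_end_def arc_points_def Let_def)

lemma connected_from_snoc:
  "connected_from z (p @ [a]) \<longleftrightarrow>
     connected_from z p \<and> arc_start a = (if p = [] then z else arc_end (last p))"
  by (induction p arbitrary: z) auto

lemma endpoint_simps [simp]: "endpoint [] = 0" "endpoint (p @ [a]) = arc_end a"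
  by (simp_all add: endpoint_def)

lemma path_in_packing_Nil [simp]: "path_in_packing []"
  by (simp add: path_in_packing_def)

lemma path_in_packing_endpoint_nonneg:
  assumes "path_in_packing p"
  shows "0 \<le> Re (endpoint p)" "0 \<le> Im (endpoint p)"
proof -
  have "0 \<le> Re (endpoint p) \<and> 0 \<le> Im (endpoint p)"
  proof (cases "p = []")
    case False
    then have "last p \<in> set p"
      by simp
    then have "0 \<le> Re (arc_end (last p)) \<and> 0 \<le> Im (arc_end (last p))"
      using assms arc_end_in_arc_points unfolding path_in_packing_def by blast
    then show ?thesis
      using False by (simp add: endpoint_def)
  qed simp
  then show "0 \<le> Re (endpoint p)" "0 \<le> Im (endpoint p)"
    by simp_all
qed

text \<open>The new arc starts at a point already in the quarter plane, so by
  \<open>arc_quadrant\<close> the condition on all its points reduces to the ordinate of its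
  end.\<close>

lemma path_in_packing_snoc:
  "path_in_packing (p @ [a]) \<longleftrightarrow>
     path_in_packing p \<and> arc_start a = endpoint p \<and> 0 \<le> Im (arc_end a)"
proof
  assume *: "path_in_packing (p @ [a])"
  then show "path_in_packing p \<and> arc_start a = endpoint p \<and> 0 \<le> Im (arc_end a)"
    using path_in_packing_endpoint_nonneg(2)[OF *]
    by (simp add: path_in_packing_def connected_from_snoc endpoint_def)
next
  assume *: "path_in_packing p \<and> arc_start a = endpoint p \<and> 0 \<le> Im (arc_end a)"
  then have "0 \<le> Re (arc_start a)" "0 \<le> Im (arc_start a)" "0 \<le> Im (arc_end a)"
    using path_in_packing_endpoint_nonneg[of p] by simp_all
  then have "\<forall>z\<in>arc_points a. 0 \<le> Re z \<and> 0 \<le> Im z"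
    using arc_quadrant by blast
  then show "path_in_packing (p @ [a])"
    using * by (simp add: path_in_packing_def connected_from_snoc endpoint_def ball_Un)
qed

lemma path_in_packing_prefix: "path_in_packing (p @ q) \<Longrightarrow> path_in_packing p"
proof (induction q rule: rev_induct)
  case (snoc a q)
  then show ?case
    using path_in_packing_snoc[of "p @ q" a] by simp
qed simp

text \<open>These are the tangency points. The class of a point (\<open>h\<close> even; \<open>h\<close> odd and \<open>x - h\<close> divisible
  by 4; \<open>h\<close> odd and \<open>x - h\<close> congruent to 2 modulo 4) fixes the two types of arcs that start there
  and the two types that end there, so the endpoint plays the role of the last step.\<close>

definition tangency :: "int \<Rightarrow> int \<Rightarrow> bool" where
  "tangency x h \<longleftrightarrow> (x - h) mod 4 = 0 \<or> (x - h) mod 4 = 2 \<and> odd h"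

lemma arc_end_tangency: "\<exists>x h. arc_end a = lattice_point x h \<and> tangency x h"
proof -
  obtain i j t where a: "a = (i, j, t)"
    by (cases a)
  show ?thesis
    unfolding a by (cases t) (simp_all add: arc_end_simps tangency_def)
qed

lemma path_in_packing_endpoint:
  assumes "path_in_packing p"
  obtains x h where "endpoint p = lattice_point x h" "tangency x h" "0 \<le> x" "0 \<le> h"
proof -
  obtain x h where *: "endpoint p = lattice_point x h" "tangency x h"
  proof (cases p rule: rev_cases)
    case Nil
    then show ?thesis
      using that[of 0 0] by (simp add: tangency_def)
  next
    case (snoc q a)
    then show ?thesis
      using that arc_end_tangency[of a] by auto
  qed
  then show ?thesis
    using that path_in_packing_endpoint_nonneg[OF assms] by (auto simp: zero_le_mult_iff)
qed

text \<open>A descent to the axis always exists: \<open>Db\<close> leaves a point of positive even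
  height, and at odd height either \<open>D\<close> is possible at once or \<open>F\<close> leads to
  a point where it is.\<close>

lemma path_in_packing_extend:
  assumes "path_in_packing p" "endpoint p = lattice_point x h" "tangency x h" "0 \<le> h"
  shows "\<exists>q. packing_path (p @ q)"
  using assms
\<comment> \<open>\<open>F\<close> keeps the height but moves \<open>x - h\<close> from 0 to 2
  modulo 4, hence the second summand; doubling \<open>h\<close> lets \<open>D\<close>, which moves
  it back to 0, still decrease the measure.\<close>
proof (induction "nat (2 * h) + of_bool ((x - h) mod 4 = 0)" arbitrary: p x h rule: less_induct)
  case less
  have step: ?case if a: "arc_start a = lattice_point x h" "arc_end a = lattice_point x' h'"
    and h': "tangency x' h'" "0 \<le> h'"
      "nat (2 * h') + of_bool ((x' - h') mod 4 = 0) < nat (2 * h) + of_bool ((x - h) mod 4 = 0)"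
    for a x' h'
  proof -
    have "path_in_packing (p @ [a])"
      using less.prems a h' by (simp add: path_in_packing_snoc)
    then have "\<exists>q. packing_path ((p @ [a]) @ q)"
      using a h' by (intro less.hyps[OF h'(3)]) simp_all
    then show ?thesis
      by auto
  qed
  consider "h = 0" | i j where "h = 2 * j" "x = 4 * i + 2 * j" "0 < j"
    | i j where "h = 2 * j + 1" "x = 4 * i + 2 * j + 1" "0 \<le> j"
    | i j where "h = 2 * j + 1" "x = 4 * i + 2 * j + 3" "0 \<le> j"
  proof -
    define i j where "i = (x - h) div 4" and "j = h div 2"
    have x: "x = 4 * i + h + (x - h) mod 4" and h: "h = 2 * j + h mod 2"
      unfolding i_def j_def by simp_all
    show ?thesis
    proof (cases "even h")
      case True
      then have "h = 2 * j" "x = 4 * i + 2 * j"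
        using h x less.prems(3) by (auto simp: tangency_def)
      then show ?thesis
        using that(1) that(2)[of j i] less.prems(4) by linarith
    next
      case False
      then have h1: "h = 2 * j + 1"
        using h by presburger
      from less.prems(3) consider "(x - h) mod 4 = 0" | "(x - h) mod 4 = 2"
        by (auto simp: tangency_def)
      then show ?thesis
      proof cases
        case 1
        then show ?thesis
          using that(3)[of j i] h1 x less.prems(4) by linarith
      next
        case 2
        then show ?thesis
          using that(4)[of j i] h1 x less.prems(4) by linarith
      qed
    qed
  qed
  then show ?case
  proof cases
    case 1
    then have "packing_path (p @ [])"
      using less.prems by (simp add: packing_path_def)
    then show ?thesis ..
  next
    case 2
    then show ?thesis
      by (intro step[of "(i, j, Db)" "4 * i + 2 * j + 1" "2 * j - 1"])
        (simp_all add: arc_start_simps arc_end_simps tangency_def)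
  next
    case 3
    then show ?thesis
      by (intro step[of "(i, j, F)" "4 * i + 2 * j + 3" "2 * j + 1"])
        (simp_all add: arc_start_simps arc_end_simps tangency_def)
  next
    case 4
    then show ?thesis
      by (intro step[of "(i, j, D)" "4 * i + 2 * j + 4" "2 * j"])
        (simp_all add: arc_start_simps arc_end_simps tangency_def)
  qed
qed

lemma partial_packing_path_iff: "partial_packing_path p \<longleftrightarrow> path_in_packing p"
proof
  assume "partial_packing_path p"
  then show "path_in_packing p"
    using path_in_packing_prefix
    by (auto simp: partial_packing_path_def packing_path_def prefix_def)
next
  assume *: "path_in_packing p"
  then obtain x h where "endpoint p = lattice_point x h" "tangency x h" "0 \<le> h"
    by (rule path_in_packing_endpoint)
  then show "partial_packing_path p"
    using path_in_packing_extend[OF *] unfolding partial_packing_path_def prefix_def by blast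
qed

section \<open>Counting paths by their last arc\<close>

definition paths_to :: "int \<Rightarrow> int \<Rightarrow> arc list set" where
  "paths_to x h = {p. path_in_packing p \<and> endpoint p = lattice_point x h}"

lemma s_eq_card_paths_to: "s n k = card (paths_to n (int k))"
  unfolding s_def paths_to_def
  by (rule arg_cong[of _ _ card]) (auto simp: partial_packing_path_iff complex_eq_iff)

lemma paths_to_eq_empty: "x < 0 \<or> h < 0 \<or> \<not> tangency x h \<Longrightarrow> paths_to x h = {}"
  by (auto simp: paths_to_def elim!: path_in_packing_endpoint)

lemma paths_to_decomp:
  assumes "0 \<le> h"
  shows "paths_to x h = (if x = 0 \<and> h = 0 then {[]} else {}) \<union>
    (\<Union>a\<in>{a. arc_end a = lattice_point x h}.
       (\<lambda>p. p @ [a]) ` {p. path_in_packing p \<and> endpoint p = arc_start a})"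
    (is "_ = ?R")
proof (rule set_eqI)
  fix p
  show "p \<in> paths_to x h \<longleftrightarrow> p \<in> ?R"
    using assms by (cases p rule: rev_cases) (auto simp: paths_to_def path_in_packing_snoc image_iff)
qed

text \<open>The end and the type of an arc determine its circle, so there is at most one arc per
  type.\<close>

lemma finite_arcs_to: "finite {a. arc_end a = lattice_point x h}"
proof (rule inj_on_finite)
  show "inj_on (\<lambda>(i, j, t). t) {a. arc_end a = lattice_point x h}"
  proof (rule inj_onI, clarsimp)
    fix i j i' j' t
    assume "arc_end (i, j, t) = lattice_point x h" "arc_end (i', j', t) = lattice_point x h"
    then show "i = i' \<and> j = j'"
      by (cases t) (auto simp: arc_end_simps)
  qed
  show "(\<lambda>(i, j, t). t) ` {a. arc_end a = lattice_point x h} \<subseteq> {U, F, D, Ub, Fb, Db}"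
    using step.exhaust by blast
qed simp

lemma arc_start_left_of_end:
  assumes "arc_end a = lattice_point x h"
  obtains x' h' where "arc_start a = lattice_point x' h'" "x' < x"
proof -
  obtain i j t where "a = (i, j, t)"
    by (cases a)
  then show ?thesis
    using assms that by (cases t) (auto simp: arc_start_simps arc_end_simps)
qed

text \<open>Induction on the width works because every arc moves strictly to the right. Finiteness
  makes \<open>card\<close> additive over the last arc.\<close>

lemma finite_paths_to: "finite (paths_to x h)"
proof -
  have "x < int m \<Longrightarrow> finite (paths_to x h)" for m
  proof (induction m arbitrary: x h)
    case 0
    then show ?case
      by (simp add: paths_to_eq_empty)
  next
    case (Suc m)
    have "finite {p. path_in_packing p \<and> endpoint p = arc_start a}"
      if arc: "arc_end a = lattice_point x h" for a
    proof -
      obtain x' h' where "arc_start a = lattice_point x' h'" "x' < x"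
        using arc_start_left_of_end[OF arc] .
      then show ?thesis
        using Suc.IH[of x' h'] Suc.prems by (simp add: paths_to_def)
    qed
    then show ?case
      by (cases "0 \<le> h") (auto simp: paths_to_decomp finite_arcs_to paths_to_eq_empty)
  qed
  from this[of "nat (x + 1)"] show ?thesis
    by (cases "0 \<le> x") (simp_all add: paths_to_eq_empty)
qed

lemma card_paths_to_two_arcs:
  assumes "0 \<le> h" "{a. arc_end a = lattice_point x h} = {a, b}" "a \<noteq> b"
    and "arc_start a = lattice_point x1 h1" "arc_start b = lattice_point x2 h2"
  shows "card (paths_to x h) =
    of_bool (x = 0 \<and> h = 0) + card (paths_to x1 h1) + card (paths_to x2 h2)"
proof -
  let ?E = "if x = 0 \<and> h = 0 then {[]} else {} :: arc list set"
  have inj: "inj_on (\<lambda>p. p @ [c]) A" for c :: arc and A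
    by (simp add: inj_on_def)
  have "paths_to x h =
      ?E \<union> ((\<lambda>p. p @ [a]) ` paths_to x1 h1 \<union> (\<lambda>p. p @ [b]) ` paths_to x2 h2)"
    using assms by (simp add: paths_to_decomp) (simp add: paths_to_def)
  also have "card \<dots> = card ?E +
      card ((\<lambda>p. p @ [a]) ` paths_to x1 h1 \<union> (\<lambda>p. p @ [b]) ` paths_to x2 h2)"
    by (rule card_Un_disjoint) (auto simp: finite_paths_to)
  also have "card ((\<lambda>p. p @ [a]) ` paths_to x1 h1 \<union> (\<lambda>p. p @ [b]) ` paths_to x2 h2) =
      card (paths_to x1 h1) + card (paths_to x2 h2)"
    using assms(3) by (subst card_Un_disjoint) (auto simp: finite_paths_to card_image[OF inj])
  finally show ?thesis
    by simp
qed

text \<open>One equation per class of tangency points. At odd height the two arcs lie on the two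
  circles touching there; at even height both lie on the circle to the left.\<close>

lemma arcs_to:
  "{a. arc_end a = lattice_point (4 * i + 2 * j + 4) (2 * j)} = {(i, j, D), (i, j, Ub)}"
  "{a. arc_end a = lattice_point (4 * i + 2 * j + 1) (2 * j + 1)} = {(i, j, U), (i - 1, j + 1, Fb)}"
  "{a. arc_end a = lattice_point (4 * i + 2 * j + 3) (2 * j + 1)} = {(i, j, F), (i, j + 1, Db)}"
proof -
  have *: "A = B" if "\<And>i j t. (i, j, t) \<in> A \<longleftrightarrow> (i, j, t) \<in> B" for A B :: "arc set"
    using that by auto
  show "{a. arc_end a = lattice_point (4 * i + 2 * j + 4) (2 * j)} = {(i, j, D), (i, j, Ub)}"
    "{a. arc_end a = lattice_point (4 * i + 2 * j + 1) (2 * j + 1)} = {(i, j, U), (i - 1, j + 1, Fb)}"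
    "{a. arc_end a = lattice_point (4 * i + 2 * j + 3) (2 * j + 1)} = {(i, j, F), (i, j + 1, Db)}"
    by (rule *, case_tac t; simp add: arc_end_simps; presburger)+
qed

text \<open>The \<open>of_bool\<close> term is the empty path: the origin is the point with
  \<open>i = -1\<close> and \<open>j = 0\<close>. For \<open>j = 0\<close> the height
  \<open>2 * j - 1\<close> is negative and its set of paths is empty.\<close>

lemma card_paths_to_rec:
  assumes "0 \<le> j"
  shows "card (paths_to (4 * i + 2 * j + 4) (2 * j)) = of_bool (i = -1 \<and> j = 0) +
      card (paths_to (4 * i + 2 * j + 3) (2 * j + 1)) + card (paths_to (4 * i + 2 * j + 3) (2 * j - 1))"
    and "card (paths_to (4 * i + 2 * j + 1) (2 * j + 1)) =
      card (paths_to (4 * i + 2 * j) (2 * j)) + card (paths_to (4 * i + 2 * j - 1) (2 * j + 1))"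
    and "card (paths_to (4 * i + 2 * j + 3) (2 * j + 1)) =
      card (paths_to (4 * i + 2 * j + 1) (2 * j + 1)) + card (paths_to (4 * i + 2 * j + 2) (2 * j + 2))"
proof -
  have "4 * i + 2 * j + 4 = 0 \<and> 2 * j = 0 \<longleftrightarrow> i = -1 \<and> j = 0"
    by auto
  then show "card (paths_to (4 * i + 2 * j + 4) (2 * j)) = of_bool (i = -1 \<and> j = 0) +
      card (paths_to (4 * i + 2 * j + 3) (2 * j + 1)) + card (paths_to (4 * i + 2 * j + 3) (2 * j - 1))"
    using assms card_paths_to_two_arcs[OF _ arcs_to(1), of j i] by (simp add: arc_start_simps)
  show "card (paths_to (4 * i + 2 * j + 1) (2 * j + 1)) =
      card (paths_to (4 * i + 2 * j) (2 * j)) + card (paths_to (4 * i + 2 * j - 1) (2 * j + 1))"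
    using assms card_paths_to_two_arcs[OF _ arcs_to(2), of j i "4 * i + 2 * j" "2 * j"
        "4 * i + 2 * j - 1" "2 * j + 1"]
    by (simp add: arc_start_simps)
  show "card (paths_to (4 * i + 2 * j + 3) (2 * j + 1)) =
      card (paths_to (4 * i + 2 * j + 1) (2 * j + 1)) + card (paths_to (4 * i + 2 * j + 2) (2 * j + 2))"
    using assms card_paths_to_two_arcs[OF _ arcs_to(3), of j i "4 * i + 2 * j + 1" "2 * j + 1"
        "4 * i + 2 * j + 2" "2 * j + 2"]
    by (simp add: arc_start_simps)
qed

section \<open>The numbers w\<close>

unbundle fps_syntax

text \<open>By Lagrange inversion, \<open>W n k = [x^n] g^k\<close> for the solution of \<open>g = x \<phi>(g)\<close> with
  \<open>\<phi>(u) = (1 + 3u) / (1 - u)\<close>.\<close>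

definition phi_power :: "nat \<Rightarrow> real fps" where
  "phi_power n = (1 + fps_const 3 * fps_X) ^ n * inverse (1 - fps_X) ^ n"

lemma one_minus_X_mult_inverse: "(1 - fps_X) * inverse (1 - fps_X :: real fps) = 1"
  by (simp add: inverse_mult_eq_1')

lemma phi_power_Suc:
  "(1 - fps_X) * phi_power (Suc n) = (1 + fps_const 3 * fps_X) * phi_power n"
proof -
  have "(1 - fps_X) * phi_power (Suc n) =
      ((1 - fps_X) * inverse (1 - fps_X)) * ((1 + fps_const 3 * fps_X) * phi_power n)"
    by (simp only: phi_power_def power_Suc mult_ac)
  then show ?thesis
    by (simp add: one_minus_X_mult_inverse)
qed

text \<open>The derivative of \<open>inverse (1 - fps_X)\<close> is its own square and
  \<open>1 + 3u\<close> has constant derivative, so the result is again a combination of the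
  \<open>phi_power\<close> series.\<close>

lemma phi_power_deriv:
  "fps_deriv ((1 + fps_const 3 * fps_X) * phi_power n) =
     of_nat n * phi_power (Suc n) + of_nat (3 * Suc n) * phi_power n"
proof -
  define A I :: "real fps" where "A = 1 + fps_const 3 * fps_X" and "I = inverse (1 - fps_X)"
  have A': "fps_deriv A = 3"
    by (simp add: A_def numeral_fps_const)
  have I': "fps_deriv I = I ^ 2"
    unfolding I_def by (subst fps_inverse_deriv) simp_all
  have In: "fps_deriv (I ^ n) = of_nat n * I ^ Suc n"
  proof (cases n)
    case (Suc m)
    then show ?thesis
      unfolding Suc fps_deriv_power' I' by (simp add: power2_eq_square mult_ac)
  qed simp
  have An: "fps_deriv (A ^ Suc n) = of_nat (3 * Suc n) * A ^ n"
    unfolding fps_deriv_power' A' by simp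
  have "fps_deriv (A ^ Suc n * I ^ n) = of_nat (3 * Suc n) * (A ^ n * I ^ n)
      + of_nat n * (A ^ Suc n * I ^ Suc n)"
    unfolding fps_deriv_mult In An by (simp add: algebra_simps)
  then show ?thesis
    by (simp add: phi_power_def A_def I_def mult.assoc)
qed

lemma phi_power_nth_0: "phi_power n $ 0 = 1"
  by (simp add: phi_power_def fps_mult_nth_0 fps_power_zeroth)

lemma phi_power_nth_Suc:
  "phi_power (Suc n) $ Suc m - phi_power (Suc n) $ m = phi_power n $ Suc m + 3 * phi_power n $ m"
  using arg_cong[OF phi_power_Suc, of "\<lambda>f. f $ Suc m" n]
  by (simp add: algebra_simps)

lemma phi_power_nth_deriv:
  "real (Suc m) * (phi_power n $ Suc m + 3 * phi_power n $ m) =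
     real n * phi_power (Suc n) $ m + 3 * real (Suc n) * phi_power n $ m"
proof -
  have "of_nat a * f = fps_const (real a) * f" for a f
    by (simp add: fps_of_nat)
  then have "real (Suc m) * phi_power n $ Suc m + 3 * (real (Suc m) * phi_power n $ m) =
      real n * phi_power (Suc n) $ m + real (3 * Suc n) * phi_power n $ m"
    using arg_cong[OF phi_power_deriv, of "\<lambda>f. f $ m" n]
    by (simp add: distrib_right mult.assoc
        del: of_nat_Suc of_nat_mult of_nat_add fps_deriv_mult mult_Suc_right)
  then show ?thesis
    by (simp add: algebra_simps)
qed

lemma one_plus_const_X_power_nth:
  "((1 + fps_const c * fps_X) ^ n :: real fps) $ m = c ^ m * real (n choose m)"
proof (induction n arbitrary: m)
  case 0
  then show ?case by (cases m) simp_all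
next
  case (Suc n)
  then show ?case by (cases m) (simp_all add: algebra_simps)
qed

text \<open>Cauchy product of the negative binomial series with the binomial expansion of
  \<open>(1 + 3u)^n\<close>.\<close>

lemma phi_power_nth:
  assumes "n \<ge> 1"
  shows "phi_power n $ m =
    (\<Sum>l=0..m. 3 ^ (m - l) * real ((n + l - 1) choose l) * real (n choose (m - l)))"
proof -
  have *: "inverse (1 - fps_X) ^ n = (Abs_fps (\<lambda>k. real ((n + k - 1) choose k)))"
    using one_minus_const_fps_X_neg_power'[of n "1::real"] assms by (simp add: fps_inverse_power)
  have "phi_power n =
      Abs_fps (\<lambda>k. real ((n + k - 1) choose k)) * (1 + fps_const 3 * fps_X) ^ n"
    unfolding phi_power_def * by (rule mult.commute)
  then show ?thesis
    by (simp only: fps_mult_nth fps_nth_Abs_fps one_plus_const_X_power_nth) (simp add: mult_ac)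
qed

lemma w_formula_eq:
  assumes "n \<ge> 1" "k \<le> n"
  shows "w_formula n k = real k / real n * phi_power n $ (n - k)"
proof -
  have "{l. k + l \<le> n} = {0..n - k}"
    using assms by auto
  then show ?thesis
    using assms by (simp add: w_formula_def phi_power_nth)
qed

lemma w_formula_eq_0: "n < k \<Longrightarrow> w_formula n k = 0"
  by (simp add: w_formula_def)

section \<open>Boundary values and recurrence of \<open>W\<close>\<close>

definition W :: "nat \<Rightarrow> nat \<Rightarrow> real" where
  "W n k = w (4 * int n - 2 * int k) k"

lemma W_0: "W 0 k = (if k = 0 then 1 else 0)"
  by (auto simp: W_def w_def)

lemma W_eq_formula: "n \<ge> 1 \<Longrightarrow> W n k = w_formula n k"
  unfolding W_def by (rule w_eq_formula)

lemma W_height_0: "W n 0 = (if n = 0 then 1 else 0)"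
  by (cases "n = 0") (simp_all add: W_0 W_eq_formula w_formula_def)

lemma W_eq_0: "n < k \<Longrightarrow> W n k = 0"
  by (cases "n = 0") (simp_all add: W_0 W_eq_formula w_formula_eq_0)

lemma W_diag: "W n n = 1"
  by (cases "n = 0") (simp_all add: W_0 W_eq_formula w_formula_eq phi_power_nth_0)

text \<open>This is the coefficient form of \<open>g = x + 3 x g + g^2\<close>.\<close>

lemma W_rec: "W (Suc n) (Suc k) = W n k + 3 * W n (Suc k) + W (Suc n) (Suc (Suc k))"
proof (cases "k < n")
  case False
  \<comment> \<open>On and beyond the diagonal the recurrence degenerates to 1 = 1 or 0 = 0.\<close>
  then consider "n = k" | "n < k"
    by linarith
  then show ?thesis
    by cases (simp_all add: W_diag W_eq_0)
next
  case True
  then obtain m where n: "n = k + Suc m"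
    by (metis add_Suc_right less_imp_Suc_add)
  \<comment> \<open>Since \<open>n - k = Suc m\<close>, these are the coefficients in
    \<open>W (Suc n) (Suc k)\<close>, \<open>W (Suc n) (Suc (Suc k))\<close>, \<open>W n k\<close>
    and \<open>W n (Suc k)\<close>, in this order.\<close>
  define a b c d where "a = phi_power (Suc n) $ Suc m" and "b = phi_power (Suc n) $ m"
    and "c = phi_power n $ Suc m" and "d = phi_power n $ m"
  have "a - b = c + 3 * d"
    unfolding a_def b_def c_def d_def by (rule phi_power_nth_Suc)
  then have a: "a = b + c + 3 * d"
    by simp
  have rel: "real (Suc m) * (c + 3 * d) = real n * b + 3 * real (Suc n) * d"
    unfolding b_def c_def d_def by (rule phi_power_nth_deriv)
  have clear_denominators: "u / v * a = x / y * c + 3 * (u / y * d) + z / v * b"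
    if "y * u * a = v * x * c + 3 * v * u * d + y * z * b" "v \<noteq> 0" "y \<noteq> 0" for u v x y z :: real
    using that by (simp add: field_simps)
  have "real n * real (Suc k) * a = real (Suc n) * real k * c
      + 3 * real (Suc n) * real (Suc k) * d + real n * real (Suc (Suc k)) * b"
    \<comment> \<open>With \<open>a\<close> eliminated, collecting terms and using
      \<open>n = k + Suc m\<close> leaves exactly \<open>rel\<close>.\<close>
    unfolding a using rel by (simp add: n algebra_simps)
  then have "real (Suc k) / real (Suc n) * a = real k / real n * c
      + 3 * (real (Suc k) / real n * d) + real (Suc (Suc k)) / real (Suc n) * b"
    using True by (intro clear_denominators) simp_all
  then show ?thesis
    using n by (simp add: W_eq_formula w_formula_eq a_def b_def c_def d_def)
qed

section \<open>Closed forms\<close>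

text \<open>The widths may be negative here: both sides are then 0, which gives the induction its base.\<close>

lemma card_paths_to_closed_form:
  fixes n k :: nat
  shows "real (card (paths_to (4 * int n - 2 * int k) (2 * int k))) =
      (W n k + W (Suc n) (Suc k)) / 2"
    and "real (card (paths_to (4 * int n - 2 * int k - 1) (2 * int k + 1))) =
      (W (Suc n) (Suc k) - W n k) / 2"
    and "real (card (paths_to (4 * int n - 2 * int k + 1) (2 * int k + 1))) = W (Suc n) (Suc k)"
proof -
  define N where "N x h = real (card (paths_to x h))" for x h
  have N_0: "N x h = 0" if "x < 0 \<or> h < 0" for x h
    using that by (auto simp: N_def paths_to_eq_empty)
  \<comment> \<open>The three forms are proved together by induction on a bound \<open>m\<close> for
    the width, since the recurrences mix the classes while lowering the width.\<close>
  have "(4 * int n - 2 * int k < int m \<longrightarrow>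
        N (4 * int n - 2 * int k) (2 * int k) = (W n k + W (Suc n) (Suc k)) / 2) \<and>
      (4 * int n - 2 * int k - 1 < int m \<longrightarrow>
        N (4 * int n - 2 * int k - 1) (2 * int k + 1) = (W (Suc n) (Suc k) - W n k) / 2) \<and>
      (4 * int n - 2 * int k + 1 < int m \<longrightarrow>
        N (4 * int n - 2 * int k + 1) (2 * int k + 1) = W (Suc n) (Suc k))" for m
  proof (induction m arbitrary: n k)
    case 0
    \<comment> \<open>A negative width forces \<open>n < k\<close>, where \<open>W\<close> vanishes,
      except for width -1 with \<open>n = k = 0\<close>, where the difference
      \<open>W 1 1 - W 0 0\<close> is 0.\<close>
    have "n < k \<or> n = 0 \<and> k = 0 \<or> \<not> 4 * int n - 2 * int k - 1 < 0"
      by linarith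
    then show ?case
      by (auto simp: N_0 W_eq_0 W_diag)
  next
    case (Suc m)
    have even: "N (4 * int n - 2 * int k) (2 * int k) = (W n k + W (Suc n) (Suc k)) / 2"
      if less: "4 * int n - 2 * int k < int (Suc m)"
    proof -
      have "N (4 * int n - 2 * int k) (2 * int k) = of_bool (n = 0 \<and> k = 0) +
          N (4 * int n - 2 * int k - 1) (2 * int k + 1) + N (4 * int n - 2 * int k - 1) (2 * int k - 1)"
      proof -
        have "int n - int k - 1 = -1 \<and> int k = 0 \<longleftrightarrow> n = 0 \<and> k = 0"
          by auto
        then show ?thesis
          using card_paths_to_rec(1)[of "int k" "int n - int k - 1"]
          by (simp add: N_def algebra_simps)
      qed
      moreover have "N (4 * int n - 2 * int k - 1) (2 * int k + 1) = (W (Suc n) (Suc k) - W n k) / 2"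
        using less Suc.IH[of n k] by simp
      \<comment> \<open>For \<open>k = 0\<close> only the empty path can contribute; for positive
        \<open>n\<close> and \<open>k\<close> this is the third form at \<open>n - 1\<close> and
        \<open>k - 1\<close>.\<close>
      moreover have "of_bool (n = 0 \<and> k = 0) + N (4 * int n - 2 * int k - 1) (2 * int k - 1) = W n k"
      proof (cases k)
        case 0
        then show ?thesis
          by (simp add: N_0 W_height_0)
      next
        case k: (Suc k')
        show ?thesis
        proof (cases n)
          case 0
          then show ?thesis
            using k by (simp add: N_0 W_0)
        next
          case (Suc n')
          then show ?thesis
            using k less Suc.IH[of n' k'] by (simp add: algebra_simps)
        qed
      qed
      ultimately show ?thesis
        by (simp add: field_simps)
    qed
    have odd_low: "N (4 * int n - 2 * int k - 1) (2 * int k + 1) = (W (Suc n) (Suc k) - W n k) / 2"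
      if less: "4 * int n - 2 * int k - 1 < int (Suc m)"
    proof -
      have "N (4 * int n - 2 * int k - 1) (2 * int k + 1) =
          N (4 * int n - 2 * int k - 3) (2 * int k + 1) + N (4 * int n - 2 * int (Suc k)) (2 * int (Suc k))"
        using card_paths_to_rec(3)[of "int k" "int n - int k - 1"] by (simp add: N_def algebra_simps)
      moreover have "N (4 * int n - 2 * int k - 3) (2 * int k + 1) = W n (Suc k)"
      proof (cases n)
        case 0
        then show ?thesis
          by (simp add: N_0 W_0)
      next
        case (Suc n')
        then show ?thesis
          using less Suc.IH[of n' k] by (simp add: algebra_simps)
      qed
      moreover have "N (4 * int n - 2 * int (Suc k)) (2 * int (Suc k)) =
          (W n (Suc k) + W (Suc n) (Suc (Suc k))) / 2"
        using less Suc.IH[of n "Suc k"] by simp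
      \<comment> \<open>The sum is half of \<open>3 * W n (Suc k) + W (Suc n) (Suc (Suc k))\<close>,
        which \<open>W_rec\<close> turns into the claimed difference.\<close>
      ultimately show ?thesis
        using W_rec[of n k] by (simp add: field_simps)
    qed
    have odd_high: "N (4 * int n - 2 * int k + 1) (2 * int k + 1) = W (Suc n) (Suc k)"
      if less: "4 * int n - 2 * int k + 1 < int (Suc m)"
    proof -
      have "N (4 * int n - 2 * int k + 1) (2 * int k + 1) =
          N (4 * int n - 2 * int k) (2 * int k) + N (4 * int n - 2 * int k - 1) (2 * int k + 1)"
        using card_paths_to_rec(2)[of "int k" "int n - int k"] by (simp add: N_def algebra_simps)
      then show ?thesis
        using less Suc.IH[of n k] by (simp add: field_simps)
    qed
    from even odd_low odd_high show ?case
      by blast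
  qed
  \<comment> \<open>This bound exceeds all three widths, also when \<open>nat\<close> truncates it
    to 0.\<close>
  from this[of "nat (4 * int n - 2 * int k + 2)"]
  show "real (card (paths_to (4 * int n - 2 * int k) (2 * int k))) =
      (W n k + W (Suc n) (Suc k)) / 2"
    "real (card (paths_to (4 * int n - 2 * int k - 1) (2 * int k + 1))) =
      (W (Suc n) (Suc k) - W n k) / 2"
    "real (card (paths_to (4 * int n - 2 * int k + 1) (2 * int k + 1))) = W (Suc n) (Suc k)"
    unfolding N_def by linarith+
qed

theorem theorem2:
  shows "(\<forall>n k :: nat. 0 \<le> 4 * int n - 2 * int k \<longrightarrow>
            real (s (4 * int n - 2 * int k) (2 * k)) =
              1 / 2 * (w (4 * int n - 2 * int k) k + w (4 * int n - 2 * (int k - 1)) (k + 1))) \<and>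
         (\<forall>n k :: nat. 0 \<le> 4 * int n - 2 * int k - 1 \<longrightarrow>
            real (s (4 * int n - 2 * int k - 1) (2 * k + 1)) =
              1 / 2 * (w (4 * int n - 2 * (int k - 1)) (k + 1) - w (4 * int n - 2 * int k) k)) \<and>
         (\<forall>n k :: nat. 0 \<le> 4 * int n - 2 * int k + 1 \<longrightarrow>
            real (s (4 * int n - 2 * int k + 1) (2 * k + 1)) =
              w (4 * int n - 2 * (int k - 1)) (k + 1)) \<and>
         (\<forall>m h :: nat.
            \<not> (\<exists>n k :: nat.
                (int m = 4 * int n - 2 * int k \<and> h = 2 * k) \<or>
                (int m = 4 * int n - 2 * int k - 1 \<and> h = 2 * k + 1) \<or>
                (int m = 4 * int n - 2 * int k + 1 \<and> h = 2 * k + 1)) \<longrightarrow>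
            s (int m) h = 0)"
proof -
  have W1: "w (4 * int n - 2 * int k) k = W n k" for n k
    by (simp add: W_def)
  have W2: "w (4 * int n - 2 * (int k - 1)) (k + 1) = W (Suc n) (Suc k)" for n k
    by (simp add: W_def algebra_simps)
  have "s (int m) h = 0"
    if none: "\<not> (\<exists>n k :: nat.
        (int m = 4 * int n - 2 * int k \<and> h = 2 * k) \<or>
        (int m = 4 * int n - 2 * int k - 1 \<and> h = 2 * k + 1) \<or>
        (int m = 4 * int n - 2 * int k + 1 \<and> h = 2 * k + 1))" for m h
  proof -
    have "\<not> tangency (int m) (int h)"
    proof
      assume "tangency (int m) (int h)"
      \<comment> \<open>In the three forms \<open>m + h\<close> is \<open>4 * n\<close>,
        \<open>4 * n\<close> and \<open>4 * n + 2\<close>, so \<open>(m + h) div 4\<close> and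
        \<open>h div 2\<close> recover \<open>n\<close> and \<open>k\<close>.\<close>
      then have "(even h \<and> (m + h) mod 4 = 0) \<or> (odd h \<and> (m + h) mod 4 = 2) \<or> (odd h \<and> (m + h) mod 4 = 0)"
        unfolding tangency_def by presburger
      then show False
      proof (elim disjE conjE)
        assume "even h" "(m + h) mod 4 = 0"
        then have "int m = 4 * int ((m + h) div 4) - 2 * int (h div 2) \<and> h = 2 * (h div 2)"
          by presburger
        then show False
          using none by blast
      next
        assume "odd h" "(m + h) mod 4 = 2"
        then have "int m = 4 * int ((m + h) div 4) - 2 * int (h div 2) + 1 \<and> h = 2 * (h div 2) + 1"
          by presburger
        then show False
          using none by blast
      next
        assume "odd h" "(m + h) mod 4 = 0"
        then have "int m = 4 * int ((m + h) div 4) - 2 * int (h div 2) - 1 \<and> h = 2 * (h div 2) + 1"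
          by presburger
        then show False
          using none by blast
      qed
    qed
    then show ?thesis
      by (simp add: s_eq_card_paths_to paths_to_eq_empty)
  qed
  then show ?thesis
    unfolding W1 W2 using card_paths_to_closed_form
    by (simp add: s_eq_card_paths_to add.commute)
qed

end
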